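(* Let $f:2^U\to\mathbb{R}_{\ge0}$ be submodular (not necessarily monotone), $U$ partitioned into $U_1,\dots,U_N$, and $k_1,\dots,k_N$ positive integers with $k_j\le|U_j|$. Let $\mathcal{P}=\{S\subseteq U:|S\cap U_j|\le k_j\ \forall j\}$, $\phi=\lfloor\sqrt{\min_{i\in[N]}k_i}\rfloor-1$ and $r_j=\lfloor k_j/\phi\rfloor$. If Block-Greedy with subroutine Greedy-Subroutine-Nonmono (described in the context) is run, its output $S$ satisfies $\mathbb{E}[f(S)]\ge\big(\frac1e-\frac{3}{e(\phi+1)}\big)f(OPT)$, where $OPT\in\arg\max_{S\in\mathcal{P}}f(S)$.
   Context: $f$ submodular: $f(A\cup\{x\})-f(A)\ge f(B\cup\{x\})-f(B)$ for $A\subseteq B\subseteq U$, $x\notin B$; $\Delta f(S,x)=f(S\cup\{x\})-f(S)$. Block-Greedy with Greedy-Subroutine-Nonmono: $S\gets\emptyset$; for $i=1,\dots,\phi$: for $j=1,\dots,N$: repeat $r_j$ times: let $M\subseteq U_j\setminus S$ be a set of size $r_j\phi$ maximizing $\sum_{x\in M}\Delta f(S,x)$, sample $u$ uniformly at random from $M$, and set $S\gets S\cup\{u\}$. Return $S$.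
   Formalization: The algorithm is run on each U_j extended so that it has at least 2·r_j·φ dummy elements that never change f (OPT stays over U); without them M may not exist, and the bound can fail for non-monotone f because elements of negative marginal are forced in. *)

theory Defs
  imports "HOL-Probability.Probability" "HOL-Library.Disjoint_Sets"
begin

definition marginal :: "('a set \<Rightarrow> real) \<Rightarrow> 'a set \<Rightarrow> 'a \<Rightarrow> real" where
  "marginal f S x = f (insert x S) - f S"

definition submodular_on :: "'a set \<Rightarrow> ('a set \<Rightarrow> real) \<Rightarrow> bool" where
  "submodular_on U f \<longleftrightarrow>
     (\<forall>A B x. A \<subseteq> B \<and> B \<subseteq> U \<and> x \<in> U - B \<longrightarrow> marginal f A x \<ge> marginal f B x)"

definition feasible :: "'a set \<Rightarrow> (nat \<Rightarrow> 'a set) \<Rightarrow> nat \<Rightarrow> (nat \<Rightarrow> nat) \<Rightarrow> 'a set set" where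
  "feasible U Us N k = {S. S \<subseteq> U \<and> (\<forall>j\<in>{1..N}. card (S \<inter> Us j) \<le> k j)}"

(* For N >= 1 and positive k the floor is at least 1, so the subtraction does not truncate.
   If the minimum is below 4 the value is 0: the algorithm makes no iterations and returns {}. *)
definition num_blocks :: "nat \<Rightarrow> (nat \<Rightarrow> nat) \<Rightarrow> nat" where
  "num_blocks N k = nat \<lfloor>sqrt (real (Min (k ` {1..N})))\<rfloor> - 1"

definition block_size :: "nat \<Rightarrow> (nat \<Rightarrow> nat) \<Rightarrow> nat \<Rightarrow> nat" where
  "block_size N k j = k j div num_blocks N k"

(* "for i = 1, ..., n do body i" for a randomized body acting on a state *)
primrec for_loop :: "(nat \<Rightarrow> 's \<Rightarrow> 's pmf) \<Rightarrow> nat \<Rightarrow> 's \<Rightarrow> 's pmf" where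
  "for_loop body 0 s = return_pmf s"
| "for_loop body (Suc n) s = bind_pmf (for_loop body n s) (body (Suc n))"

(* A selection rule sel says which maximizer M = sel i j t S is used in repetition t of the
   subroutine for part j in block i, when the current set is S.  It is constrained only by
   maximality, so ties may be broken arbitrarily.  V j is the j-th part of the ground set on
   which the algorithm runs; states in which V j - S has no subset of the required size
   are left unconstrained. *)
definition greedy_selection ::
  "('b set \<Rightarrow> real) \<Rightarrow> (nat \<Rightarrow> 'b set) \<Rightarrow> nat \<Rightarrow> (nat \<Rightarrow> nat)
     \<Rightarrow> (nat \<Rightarrow> nat \<Rightarrow> nat \<Rightarrow> 'b set \<Rightarrow> 'b set) \<Rightarrow> bool" where
  "greedy_selection g V N k sel \<longleftrightarrow>
     (\<forall>i\<in>{1..num_blocks N k}. \<forall>j\<in>{1..N}. \<forall>t\<in>{1..block_size N k j}.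
      \<forall>S \<subseteq> (\<Union>l\<in>{1..N}. V l).
        block_size N k j * num_blocks N k \<le> card (V j - S) \<longrightarrow>
        is_arg_max (\<lambda>M. \<Sum>x\<in>M. marginal g S x)
          (\<lambda>M. M \<subseteq> V j - S \<and> card M = block_size N k j * num_blocks N k)
          (sel i j t S))"

definition greedy_subroutine_nonmono ::
  "(nat \<Rightarrow> 'b set \<Rightarrow> 'b set) \<Rightarrow> nat \<Rightarrow> 'b set \<Rightarrow> 'b set pmf" where
  "greedy_subroutine_nonmono M r =
     for_loop (\<lambda>t S. map_pmf (\<lambda>u. insert u S) (pmf_of_set (M t S))) r"

definition block_greedy ::
  "nat \<Rightarrow> (nat \<Rightarrow> nat) \<Rightarrow> (nat \<Rightarrow> nat \<Rightarrow> nat \<Rightarrow> 'b set \<Rightarrow> 'b set) \<Rightarrow> 'b set pmf" where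
  "block_greedy N k sel =
     for_loop (\<lambda>i. for_loop (\<lambda>j. greedy_subroutine_nonmono (sel i j) (block_size N k j)) N)
       (num_blocks N k) {}"

(* Dummy elements.  Sets M of size r_j * phi need not exist in U_j - S, and even if they do,
   being forced to add elements of negative marginal value destroys the guarantee.  As usual
   for random greedy algorithms, the ground set therefore has to contain enough elements that
   never change the value of f.  pad_part d Us j is U_j extended by d j fresh such elements
   and pad_fun f evaluates f after discarding them. *)
definition dummies :: "('a set \<Rightarrow> real) \<Rightarrow> 'a set \<Rightarrow> 'a set \<Rightarrow> 'a set" where
  "dummies f U A = {x \<in> A. \<forall>S \<subseteq> U. f (insert x S) = f S}"

definition pad_part :: "(nat \<Rightarrow> nat) \<Rightarrow> (nat \<Rightarrow> 'a set) \<Rightarrow> nat \<Rightarrow> ('a + nat \<times> nat) set" where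
  "pad_part d Us j = Inl ` Us j \<union> Inr ` ({j} \<times> {..<d j})"

definition pad_fun :: "('a set \<Rightarrow> real) \<Rightarrow> ('a + nat \<times> nat) set \<Rightarrow> real" where
  "pad_fun f S = f (Inl -` S)"

end

theory Submission
  imports Defs
begin

text \<open>
  Write \<open>\<phi>\<close> for the number of blocks, \<open>r\<^sub>j\<close> for the block sizes, \<open>q = 1 - 1/\<phi>\<close>,
  and \<open>S\<^sub>i\<close> for the state after \<open>i\<close> blocks.
  A single draw from part \<open>j\<close> gains in expectation at least \<open>1/k\<^sub>j\<close> times the sum of the positive
  parts of the marginals of the elements of \<open>OPT\<close> in that part.  These sums only decrease as the
  state grows, so they may all be evaluated at the end of the block; as \<open>r\<^sub>j/k\<^sub>j \<ge> 1/(\<phi>+1)\<close>, this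
  gives \<open>E f(S\<^sub>i) - E f(S\<^sub>i\<^sub>-\<^sub>1) \<ge> (E f(S\<^sub>i \<union> OPT) - E f(S\<^sub>i)) / (\<phi>+1)\<close>.
  A fixed element survives a block unselected with probability at least
  \<open>(1 - 1/(r\<^sub>j \<phi>))^r\<^sub>j \<ge> q\<close>, so that \<open>E f(S\<^sub>i \<union> OPT) \<ge> q^i f(OPT)\<close> by submodularity.
  Solving the recursion yields \<open>E f(S\<^sub>\<phi>) \<ge> \<phi>/(\<phi>+2) q^\<phi> f(OPT)\<close>, and \<open>q^(\<phi>-1) \<ge> 1/e\<close>.
\<close>

section \<open>Randomized loops\<close>

text \<open>A Hoare triple for randomized steps that also carries a submartingale-type potential
  inequality. Finite support is part of it so that every potential is integrable and expectations
  may be compared pointwise on the support.\<close>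

definition drift ::
  "('s \<Rightarrow> bool) \<Rightarrow> ('s \<Rightarrow> real) \<Rightarrow> ('s \<Rightarrow> 't pmf) \<Rightarrow> ('t \<Rightarrow> bool) \<Rightarrow> ('t \<Rightarrow> real) \<Rightarrow> bool" where
  "drift P h K Q h' \<longleftrightarrow>
     (\<forall>s. P s \<longrightarrow> finite (set_pmf (K s)) \<and> (\<forall>s'\<in>set_pmf (K s). Q s') \<and>
        h s \<le> measure_pmf.expectation (K s) h')"

lemma expectation_mono_pmf:
  fixes h h' :: "'s \<Rightarrow> real"
  assumes "finite (set_pmf p)" and "\<And>s. s \<in> set_pmf p \<Longrightarrow> h s \<le> h' s"
  shows "measure_pmf.expectation p h \<le> measure_pmf.expectation p h'"
  by (intro integral_mono_AE integrable_measure_pmf_finite assms AE_pmfI)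

lemma expectation_bind_pmf:
  fixes h :: "'t \<Rightarrow> real"
  assumes "finite (set_pmf p)" and "\<And>s. s \<in> set_pmf p \<Longrightarrow> finite (set_pmf (K s))"
  shows "measure_pmf.expectation (bind_pmf p K) h =
         measure_pmf.expectation p (\<lambda>s. measure_pmf.expectation (K s) h)"
  using assms
  by (subst pmf_expectation_bind[of "set_pmf p"]) (auto simp: integral_measure_pmf[of "set_pmf p"])

lemma drift_bind_pmf:
  assumes K: "drift P h K Q h'" and L: "drift Q h' L R h''"
  shows "drift P h (\<lambda>s. bind_pmf (K s) L) R h''"
  unfolding drift_def
proof (intro allI impI conjI)
  fix s assume "P s"
  with K have fin: "finite (set_pmf (K s))" and Q: "\<And>s'. s' \<in> set_pmf (K s) \<Longrightarrow> Q s'"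
    and le: "h s \<le> measure_pmf.expectation (K s) h'"
    by (auto simp: drift_def)
  from L Q show "finite (set_pmf (bind_pmf (K s) L))" "\<forall>s'\<in>set_pmf (bind_pmf (K s) L). R s'"
    by (auto simp: drift_def fin)
  note le
  also have "measure_pmf.expectation (K s) h' \<le>
      measure_pmf.expectation (K s) (\<lambda>s'. measure_pmf.expectation (L s') h'')"
    using L Q by (intro expectation_mono_pmf fin) (auto simp: drift_def)
  also have "\<dots> = measure_pmf.expectation (bind_pmf (K s) L) h''"
    using L Q by (intro expectation_bind_pmf[symmetric] fin) (auto simp: drift_def)
  finally show "h s \<le> measure_pmf.expectation (bind_pmf (K s) L) h''" .
qed

text \<open>Invariant and potential are indexed by the number of completed iterations. A potential
  can thus spend a decay factor, or accumulate a deduction, at each iteration.\<close>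

lemma drift_for_loop:
  assumes "\<And>n. n < m \<Longrightarrow> drift (P n) (h n) (body (Suc n)) (P (Suc n)) (h (Suc n))"
  shows "drift (P 0) (h 0) (for_loop body m) (P m) (h m)"
  using assms
proof (induction m)
  case 0
  show ?case by (simp add: drift_def)
next
  case (Suc m)
  then have "drift (P 0) (h 0) (\<lambda>s. bind_pmf (for_loop body m s) (body (Suc m)))
      (P (Suc m)) (h (Suc m))"
    by (intro drift_bind_pmf[where Q = "P m" and h' = "h m"]) auto
  then show ?case by (simp add: drift_def)
qed

lemma drift_mono:
  assumes "drift P h K Q h'" and "\<And>s. P' s \<Longrightarrow> P s \<and> h1 s \<le> h s"
    and "\<And>s. Q s \<Longrightarrow> Q' s \<and> h' s \<le> h1' s"
  shows "drift P' h1 K Q' h1'"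
  unfolding drift_def
proof (intro allI impI conjI)
  fix s assume "P' s"
  with assms have fin: "finite (set_pmf (K s))" and Q: "\<And>s'. s' \<in> set_pmf (K s) \<Longrightarrow> Q s'"
    and le: "h1 s \<le> h s" "h s \<le> measure_pmf.expectation (K s) h'"
    by (auto simp: drift_def)
  show "finite (set_pmf (K s))" by fact
  show "\<forall>s'\<in>set_pmf (K s). Q' s'" using Q assms(3) by blast
  have "measure_pmf.expectation (K s) h' \<le> measure_pmf.expectation (K s) h1'"
    using Q assms(3) by (intro expectation_mono_pmf fin) blast
  with le show "h1 s \<le> measure_pmf.expectation (K s) h1'" by linarith
qed

section \<open>Submodular functions\<close>

lemma submodular_onD:
  "submodular_on U g \<Longrightarrow> A \<subseteq> B \<Longrightarrow> B \<subseteq> U \<Longrightarrow> x \<in> U \<Longrightarrow> x \<notin> B \<Longrightarrow>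
     marginal g B x \<le> marginal g A x"
  by (auto simp: submodular_on_def)

text \<open>For \<open>x\<close> in \<open>T\<close> both marginals vanish; otherwise submodularity
  of \<open>g\<close> applies to the enlarged sets. It is needed for \<open>T = OPT\<close>.\<close>

lemma submodular_on_union:
  assumes "submodular_on U g" and "T \<subseteq> U"
  shows "submodular_on U (\<lambda>A. g (A \<union> T))"
  unfolding submodular_on_def
proof (intro allI impI)
  fix A B x assume *: "A \<subseteq> B \<and> B \<subseteq> U \<and> x \<in> U - B"
  show "marginal (\<lambda>A. g (A \<union> T)) B x \<le> marginal (\<lambda>A. g (A \<union> T)) A x"
  proof (cases "x \<in> T")
    case True
    then show ?thesis by (simp add: marginal_def insert_absorb)
  next
    case False
    then show ?thesis
      using submodular_onD[OF assms(1), of "A \<union> T" "B \<union> T" x] * assms(2)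
      by (auto simp: marginal_def)
  qed
qed

text \<open>Telescoping: an element added on top of others from \<open>T\<close> contributes no more
  than it would on \<open>S\<close> alone.\<close>

lemma submodular_union_le:
  assumes sub: "submodular_on U g" and "finite T" and "S \<subseteq> U" and "T \<subseteq> U - S"
  shows "g (S \<union> T) - g S \<le> (\<Sum>x\<in>T. marginal g S x)"
  using assms(2,4)
proof (induction T)
  case empty
  show ?case by simp
next
  case (insert x T)
  have "marginal g (S \<union> T) x \<le> marginal g S x"
    using insert \<open>S \<subseteq> U\<close> by (intro submodular_onD[OF sub]) auto
  with insert show ?case by (simp add: marginal_def)
qed

text \<open>
  Adding the elements in order of decreasing probability is what makes the telescoping sum
  nonnegative; the extra term \<open>q * h W\<close> carries it through the induction.
\<close>
lemma submodular_expectation_aux: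
  fixes h :: "'b set \<Rightarrow> real"
  assumes sub: "submodular_on V h" and nn: "\<And>A. A \<subseteq> V \<Longrightarrow> 0 \<le> h A"
    and "finite V" and supp: "\<And>A. A \<in> set_pmf p \<Longrightarrow> A \<subseteq> V"
    and P: "\<And>u. u \<in> V \<Longrightarrow> measure_pmf.expectation p (\<lambda>A. of_bool (u \<in> A)) \<le> P"
    and W: "W \<subseteq> V"
    and q: "q \<le> P" "\<And>u. u \<in> W \<Longrightarrow> q \<le> measure_pmf.expectation p (\<lambda>A. of_bool (u \<in> A))"
  shows "(1 - P) * h {} + q * h W \<le> measure_pmf.expectation p (\<lambda>A. h (A \<inter> W))"
proof -
  let ?pr = "\<lambda>u. measure_pmf.expectation p (\<lambda>A. of_bool (u \<in> A) :: real)"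
  have "set_pmf p \<subseteq> Pow V" using supp by blast
  then have fin: "finite (set_pmf p)" using \<open>finite V\<close> finite_subset by blast
  note int = integrable_measure_pmf_finite[OF fin]
  have "finite W" using W \<open>finite V\<close> finite_subset by blast
  then show ?thesis using W q
  proof (induction W arbitrary: q rule: finite_ranking_induct[where f = "\<lambda>u. - ?pr u"])
    case empty
    have "q * h {} \<le> P * h {}" using empty nn[of "{}"] by (intro mult_right_mono) auto
    then show ?case by (simp add: algebra_simps)
  next
    case (insert u W)
    show ?case
    proof (cases "u \<in> W")
      case True
      then show ?thesis using insert by (simp add: insert_absorb)
    next
      case False
      \<comment> \<open>The ranking is by negated probability, so \<open>u\<close> is the least
        probable element so far, and its own probability is an admissible \<open>q\<close> for
        \<open>W\<close>.\<close>
      have IH: "(1 - P) * h {} + ?pr u * h W \<le> measure_pmf.expectation p (\<lambda>A. h (A \<inter> W))"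
        using insert P by (intro insert.IH) auto
      have "measure_pmf.expectation p (\<lambda>A. h (A \<inter> W)) + ?pr u * marginal h W u
          = measure_pmf.expectation p (\<lambda>A. h (A \<inter> W) + of_bool (u \<in> A) * marginal h W u)"
        by (subst Bochner_Integration.integral_add) (auto intro: int)
      also have "\<dots> \<le> measure_pmf.expectation p (\<lambda>A. h (A \<inter> insert u W))"
      proof (intro expectation_mono_pmf fin)
        fix A
        have "marginal h W u \<le> marginal h (A \<inter> W) u"
          using insert False by (intro submodular_onD[OF sub]) auto
        then show "h (A \<inter> W) + of_bool (u \<in> A) * marginal h W u \<le> h (A \<inter> insert u W)"
          by (auto simp: marginal_def)
      qed
      finally have "(1 - P) * h {} + ?pr u * h (insert u W)
          \<le> measure_pmf.expectation p (\<lambda>A. h (A \<inter> insert u W))"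
        using IH by (simp add: marginal_def algebra_simps)
      moreover have "q * h (insert u W) \<le> ?pr u * h (insert u W)"
        using insert nn by (intro mult_right_mono) auto
      ultimately show ?thesis by linarith
    qed
  qed
qed

lemma submodular_expectation_ge:
  fixes h :: "'b set \<Rightarrow> real"
  assumes sub: "submodular_on V h" and nn: "\<And>A. A \<subseteq> V \<Longrightarrow> 0 \<le> h A"
    and fin: "finite V" and supp: "\<And>A. A \<in> set_pmf p \<Longrightarrow> A \<subseteq> V"
    and P: "\<And>u. u \<in> V \<Longrightarrow> measure_pmf.expectation p (\<lambda>A. of_bool (u \<in> A)) \<le> P"
    and "0 \<le> P"
  shows "(1 - P) * h {} \<le> measure_pmf.expectation p h"
proof -
  \<comment> \<open>The choice \<open>W = V\<close> and \<open>q = 0\<close>, admissible because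
    \<open>P\<close> is nonnegative.\<close>
  have "(1 - P) * h {} + 0 * h V \<le> measure_pmf.expectation p (\<lambda>A. h (A \<inter> V))"
    by (intro submodular_expectation_aux[OF sub nn fin supp P]) (use \<open>0 \<le> P\<close> in auto)
  also have "\<dots> = measure_pmf.expectation p h"
    by (intro integral_cong_AE AE_pmfI) (auto simp: Int_absorb2 supp)
  finally show ?thesis by simp
qed

section \<open>Numerical estimates\<close>

lemma num_blocks_square_le:
  assumes "0 < num_blocks N k" and "j \<in> {1..N}"
  shows "(num_blocks N k + 1)\<^sup>2 \<le> k j"
proof -
  define x where "x = real (Min (k ` {1..N}))"
  \<comment> \<open>A positive block count means that the natural subtraction did not
    truncate.\<close>
  have eq: "int (num_blocks N k + 1) = \<lfloor>sqrt x\<rfloor>"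
    using assms(1) unfolding num_blocks_def x_def[symmetric] by linarith
  have "real (num_blocks N k + 1) = of_int (int (num_blocks N k + 1))"
    by simp
  also have "\<dots> \<le> sqrt x"
    unfolding eq by simp
  finally have "(real (num_blocks N k + 1))\<^sup>2 \<le> (sqrt x)\<^sup>2"
    by (intro power_mono) auto
  then have "real ((num_blocks N k + 1)\<^sup>2) \<le> x"
    by (simp add: x_def)
  also have "x \<le> k j"
    using assms(2) by (simp add: x_def)
  finally show ?thesis
    by (simp only: of_nat_le_iff)
qed

text \<open>This is where the square root pays off: the block count is at most every block size, so
  the remainder lost in the division by it is smaller than one further block of size
  \<open>block_size N k j\<close>.\<close>

lemma block_size_bounds:
  assumes "0 < num_blocks N k" and "j \<in> {1..N}"
  shows "0 < block_size N k j" and "k j \<le> block_size N k j * (num_blocks N k + 1)"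
    and "block_size N k j * num_blocks N k \<le> k j"
proof -
  let ?n = "num_blocks N k" and ?r = "block_size N k j"
  have sq: "(?n + 1)\<^sup>2 \<le> k j" by (rule num_blocks_square_le[OF assms])
  have "?n * ?n \<le> k j" using sq by (simp add: power2_eq_square)
  then have ge: "?n \<le> ?r"
    unfolding block_size_def using assms(1) by (simp add: less_eq_div_iff_mult_less_eq)
  then show "0 < ?r" using assms(1) by simp
  show "?r * ?n \<le> k j" unfolding block_size_def by simp
  have "k j mod ?n < ?n" using assms(1) by simp
  moreover have "k j = ?r * ?n + k j mod ?n" unfolding block_size_def by (rule div_mult_mod_eq[symmetric])
  ultimately show "k j \<le> ?r * (?n + 1)"
    using ge unfolding distrib_left by linarith
qed

text \<open>Invert \<open>1 / (1 - 1/n) = 1 + 1/(n-1) \<le> exp (1/(n-1))\<close> and raise to the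
  power \<open>n - 1\<close>. For \<open>n = 1\<close> the power is
  \<open>0 ^ 0 = 1\<close>.\<close>

lemma one_minus_inverse_power_ge:
  assumes "0 < (n::nat)"
  shows "exp (-1) \<le> (1 - 1 / real n) ^ (n - 1)"
proof (cases "n = 1")
  case False
  with assms have n: "1 < real n" by linarith
  have "exp (- (1 / real (n - 1))) \<le> 1 - 1 / real n"
  proof -
    have "1 / (1 - 1 / real n) = 1 + 1 / real (n - 1)"
      using n by (simp add: field_simps of_nat_diff)
    also have "\<dots> \<le> exp (1 / real (n - 1))" by (rule exp_ge_add_one_self)
    finally show ?thesis using n by (simp add: exp_minus field_simps)
  qed
  then have "exp (- (1 / real (n - 1))) ^ (n - 1) \<le> (1 - 1 / real n) ^ (n - 1)"
    by (intro power_mono) auto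
  then show ?thesis
    using n by (simp add: exp_of_nat_mult[symmetric])
qed auto

text \<open>After cancelling \<open>P \<inter> M\<close>, the threshold \<open>c\<close> separates
  the rest, so \<open>sum w P - sum w M\<close> is at most \<open>(card P - card M) * c\<close>.
  Since \<open>c\<close> is nonnegative and at most the average of \<open>w\<close> over
  \<open>M\<close>, the missing \<open>n - card M\<close> elements can be charged to that
  average.\<close>

lemma top_elements_sum_le:
  fixes w :: "'b \<Rightarrow> real"
  assumes fin: "finite M" "finite P" and "0 \<le> c"
    and M: "\<And>y. y \<in> M \<Longrightarrow> c \<le> w y" and P: "\<And>x. x \<in> P - M \<Longrightarrow> w x \<le> c"
    and card: "card P \<le> n" "card M \<le> n"
  shows "card M * sum w P \<le> n * sum w M"
proof -
  let ?m = "real (card M)"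
  have sP: "sum w P = sum w (P \<inter> M) + sum w (P - M)"
    using fin by (metis sum.Int_Diff)
  have sM: "sum w M = sum w (P \<inter> M) + sum w (M - P)"
    using fin by (metis sum.Int_Diff Int_commute)
  have le1: "sum w (P - M) \<le> card (P - M) * c"
    using sum_bounded_above[of "P - M" w c] P by auto
  have le2: "card (M - P) * c \<le> sum w (M - P)"
    using sum_bounded_below[of "M - P" c w] M by auto
  have le3: "?m * c \<le> sum w M"
    using sum_bounded_below[of M c w] M by auto
  have "card (M - P) + card (P \<inter> M) = card M" "card (P - M) + card (P \<inter> M) = card P"
    using fin by (metis card_Diff_subset_Int card_Int_Diff add.commute Int_commute)+
  then have diff: "real (card (M - P)) - real (card (P - M)) = ?m - real (card P)"
    by linarith
  have "?m * (sum w P - sum w M) \<le> ?m * ((real (card (P - M)) - real (card (M - P))) * c)"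
    using le1 le2 sP sM by (intro mult_left_mono) (auto simp: algebra_simps)
  also have "\<dots> = ?m * c * (real (card P) - ?m)"
  proof -
    have "real (card (P - M)) - real (card (M - P)) = real (card P) - ?m"
      using diff by linarith
    then show ?thesis by (simp only: mult.assoc mult.commute[of c])
  qed
  also have "\<dots> \<le> ?m * c * (real n - ?m)"
    using card \<open>0 \<le> c\<close> by (intro mult_left_mono) auto
  also have "\<dots> \<le> sum w M * (real n - ?m)"
    using le3 card by (intro mult_right_mono) auto
  finally show ?thesis by (simp add: algebra_simps)
qed

section \<open>Block greedy on a ground set with dummy elements\<close>

text \<open>The analysis is done for an abstract ground set that already contains the dummies
  \<open>D j\<close>. Their number is twice \<open>r j * n\<close> because fewer than
  \<open>r j * n\<close> elements of part \<open>j\<close> are present before any draw from it, so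
  enough unselected dummies remain to fill a whole candidate set.\<close>

locale padded_instance =
  fixes V :: "nat \<Rightarrow> 'b set" and N :: nat and k :: "nat \<Rightarrow> nat" and g :: "'b set \<Rightarrow> real"
    and sel :: "nat \<Rightarrow> nat \<Rightarrow> nat \<Rightarrow> 'b set \<Rightarrow> 'b set" and OPT :: "'b set" and D :: "nat \<Rightarrow> 'b set"
  fixes ground :: "'b set" and n :: nat and r :: "nat \<Rightarrow> nat"
  defines "ground \<equiv> (\<Union>l\<in>{1..N}. V l)"
    and "n \<equiv> num_blocks N k" and "r \<equiv> block_size N k"
  assumes finite_V: "\<And>j. j \<in> {1..N} \<Longrightarrow> finite (V j)"
    and disjoint_V: "disjoint_family_on V {1..N}"
    and g_nonneg: "\<And>S. S \<subseteq> ground \<Longrightarrow> 0 \<le> g S"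
    and g_submodular: "submodular_on ground g"
    and OPT_subset: "OPT \<subseteq> ground"
    and card_OPT: "\<And>j. j \<in> {1..N} \<Longrightarrow> card (OPT \<inter> V j) \<le> k j"
    and D_subset: "\<And>j. j \<in> {1..N} \<Longrightarrow> D j \<subseteq> V j"
    and g_insert_dummy: "\<And>j x S. j \<in> {1..N} \<Longrightarrow> x \<in> D j \<Longrightarrow> S \<subseteq> ground \<Longrightarrow> g (insert x S) = g S"
    and card_D: "\<And>j. j \<in> {1..N} \<Longrightarrow> 2 * (r j * n) \<le> card (D j)"
    and greedy_sel: "greedy_selection g V N k sel"
    and n_pos: "0 < n"
begin

section \<open>Basic facts, the invariant on part sizes, and the gain of a part\<close>

lemma finite_ground: "finite ground"
  using finite_V by (auto simp: ground_def)

lemma V_subset_ground: "j \<in> {1..N} \<Longrightarrow> V j \<subseteq> ground"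
  by (auto simp: ground_def)

lemma V_eqI: "j \<in> {1..N} \<Longrightarrow> l \<in> {1..N} \<Longrightarrow> u \<in> V j \<Longrightarrow> u \<in> V l \<Longrightarrow> l = j"
  using disjoint_V unfolding disjoint_family_on_def by blast

lemma r_pos: "j \<in> {1..N} \<Longrightarrow> 0 < r j"
  and k_le: "j \<in> {1..N} \<Longrightarrow> k j \<le> r j * (n + 1)"
  and r_le: "j \<in> {1..N} \<Longrightarrow> r j * n \<le> k j"
  using block_size_bounds n_pos unfolding n_def r_def by auto

text \<open>The invariant of the run: \<open>c l\<close> counts the draws made from part
  \<open>l\<close> so far. The upper bounds are what keeps unselected dummies available.\<close>

definition quota :: "(nat \<Rightarrow> nat) \<Rightarrow> 'b set \<Rightarrow> bool" where
  "quota c S \<longleftrightarrow> S \<subseteq> ground \<and> (\<forall>l\<in>{1..N}. card (S \<inter> V l) \<le> c l)"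

text \<open>Positive parts make the sum decrease as \<open>S\<close> grows, even when an element of
  \<open>OPT\<close> with negative marginal leaves the index set.\<close>

definition gain :: "nat \<Rightarrow> 'b set \<Rightarrow> real" where
  "gain j S = (\<Sum>x\<in>OPT \<inter> V j - S. max 0 (marginal g S x))"

lemma finite_OPT: "finite OPT"
  using OPT_subset finite_ground finite_subset by blast

lemma gain_insert_le:
  assumes "j \<in> {1..N}" and "S \<subseteq> ground" and "u \<in> ground"
  shows "gain j (insert u S) \<le> gain j S"
proof -
  have "gain j (insert u S) \<le> (\<Sum>x\<in>OPT \<inter> V j - insert u S. max 0 (marginal g S x))"
    unfolding gain_def
  proof (intro sum_mono max.mono order_refl)
    fix x assume "x \<in> OPT \<inter> V j - insert u S"
    with assms OPT_subset show "marginal g (insert u S) x \<le> marginal g S x"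
      by (intro submodular_onD[OF g_submodular]) auto
  qed
  also have "\<dots> \<le> gain j S"
    unfolding gain_def using finite_OPT by (intro sum_mono2) auto
  finally show ?thesis .
qed

section \<open>A single draw\<close>

definition draw :: "nat \<Rightarrow> nat \<Rightarrow> nat \<Rightarrow> 'b set \<Rightarrow> 'b set pmf" where
  "draw i j t S = map_pmf (\<lambda>u. insert u S) (pmf_of_set (sel i j t S))"

text \<open>By maximality the lightest element \<open>y0\<close> of \<open>M\<close> weighs at least
  as much as any candidate outside \<open>M\<close>, and the dummies force its weight to be
  nonnegative. So \<open>?w y0\<close> can be the threshold in
  \<open>top_elements_sum_le\<close>.\<close>

lemma greedy_gain:
  assumes j: "j \<in> {1..N}" and "S \<subseteq> ground" and card_S: "card (S \<inter> V j) < r j * n"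
    and max: "is_arg_max (\<lambda>M. \<Sum>x\<in>M. marginal g S x) (\<lambda>M. M \<subseteq> V j - S \<and> card M = r j * n) M"
  shows "real (r j * n) * gain j S \<le> k j * (\<Sum>x\<in>M. marginal g S x)"
proof -
  let ?w = "marginal g S"
  have M: "M \<subseteq> V j - S" "card M = r j * n"
    using max by (auto simp: is_arg_max_def)
  have pos: "0 < r j * n" using r_pos[OF j] n_pos by simp
  have finM: "finite M" "M \<noteq> {}" using M pos card_gt_0_iff by force+
  obtain y0 where y0: "y0 \<in> M" "\<And>y. y \<in> M \<Longrightarrow> ?w y0 \<le> ?w y"
    using finM arg_min_if_finite(1)[OF finM, of ?w] arg_min_least[OF finM, of _ ?w] by blast
  \<comment> \<open>Exchange argument: replacing \<open>y0\<close> by a heavier candidate would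
    improve \<open>M\<close>.\<close>
  have swap: "?w x \<le> ?w y0" if x: "x \<in> V j - S" "x \<notin> M" for x
  proof (rule ccontr)
    assume less: "\<not> ?w x \<le> ?w y0"
    let ?M = "insert x (M - {y0})"
    have "?M \<subseteq> V j - S" "card ?M = r j * n"
      using M x y0 finM pos by (auto simp: card_insert_if)
    with max have "sum ?w ?M \<le> sum ?w M"
      by (auto simp: is_arg_max_def not_less)
    moreover have "sum ?w ?M = ?w x + (sum ?w M - ?w y0)"
      using x finM y0 by (simp add: sum_diff1)
    ultimately show False using less by simp
  qed
  have dummy: "?w x = 0" if "x \<in> D j" for x
    using g_insert_dummy[OF j that \<open>S \<subseteq> ground\<close>] by (simp add: marginal_def)
  \<comment> \<open>If \<open>y0\<close> is not a dummy, then \<open>M\<close> cannot contain all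
    unselected dummies, which number at least \<open>card M\<close>. One left outside has weight 0,
    and \<open>swap\<close> compares it with \<open>y0\<close>.\<close>
  have "0 \<le> ?w y0"
  proof (cases "y0 \<in> D j")
    case False
    have finD: "finite (D j)" using D_subset[OF j] finite_V[OF j] finite_subset by blast
    have "card (D j \<inter> S) \<le> card (S \<inter> V j)"
      using D_subset[OF j] finite_V[OF j] by (intro card_mono) auto
    then have "card M \<le> card (D j - S)"
      using card_D[OF j] card_S M(2) finD by (simp add: card_Diff_subset_Int)
    have "\<not> D j - S \<subseteq> M"
    proof
      assume "D j - S \<subseteq> M"
      with y0 False have "D j - S \<subset> M" by auto
      then have "card (D j - S) < card M" using finM by (intro psubset_card_mono)
      with \<open>card M \<le> card (D j - S)\<close> show False by simp
    qed
    then obtain x where "x \<in> D j" "x \<notin> S" "x \<notin> M" by blast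
    with swap[of x] dummy[of x] D_subset[OF j] show ?thesis by auto
  qed (use dummy in auto)
  then have nonneg: "0 \<le> ?w y" if "y \<in> M" for y
    using y0(2)[OF that] by linarith
  have "card (OPT \<inter> V j - S) \<le> k j"
    using card_OPT[OF j] card_mono[of "OPT \<inter> V j" "OPT \<inter> V j - S"] finite_OPT by fastforce
  \<comment> \<open>As the threshold is nonnegative, it still separates after passing to positive
    parts.\<close>
  then have "card M * (\<Sum>x\<in>OPT \<inter> V j - S. max 0 (?w x)) \<le> k j * (\<Sum>x\<in>M. max 0 (?w x))"
    using finM finite_OPT \<open>0 \<le> ?w y0\<close> y0(2) swap M r_le[OF j]
    by (intro top_elements_sum_le[where c = "?w y0"]) (auto simp: le_max_iff_disj)
  moreover have "(\<Sum>x\<in>M. max 0 (?w x)) = (\<Sum>x\<in>M. ?w x)"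
    using nonneg by (intro sum.cong) auto
  ultimately show ?thesis
    by (simp add: M gain_def)
qed

text \<open>The premise \<open>step\<close> is the drift inequality averaged over \<open>M\<close>,
  with the denominator \<open>r j * n\<close> cleared. It isolates what depends on the potential, so
  that the gain argument and the survival argument share the rest.\<close>

lemma drift_draw:
  assumes i: "i \<in> {1..n}" and j: "j \<in> {1..N}" and t: "t \<in> {1..r j}" and c: "c j < r j * n"
    and c': "c' = c(j := Suc (c j))"
    and step: "\<And>S M. S \<subseteq> ground \<Longrightarrow> M \<subseteq> V j - S \<Longrightarrow> card M = r j * n \<Longrightarrow>
      real (r j * n) * gain j S \<le> k j * (\<Sum>x\<in>M. marginal g S x) \<Longrightarrow>
      real (r j * n) * h S \<le> (\<Sum>u\<in>M. h' (insert u S))"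
  shows "drift (quota c) h (draw i j t) (quota c') h'"
  unfolding drift_def
proof (intro allI impI)
  fix S assume S: "quota c S"
  define M where "M = sel i j t S"
  have sub: "S \<subseteq> ground" and card_S: "card (S \<inter> V j) < r j * n"
    using S c j by (auto simp: quota_def intro: le_less_trans)
  have finS: "finite S" using sub finite_ground finite_subset by blast
  have "card (D j - S) \<le> card (V j - S)"
    using D_subset[OF j] finite_V[OF j] by (intro card_mono) auto
  moreover have "card (D j \<inter> S) \<le> card (S \<inter> V j)"
    using D_subset[OF j] finite_V[OF j] by (intro card_mono) auto
  moreover have "card (D j - S) = card (D j) - card (D j \<inter> S)"
    using finS by (intro card_Diff_subset_Int) auto
  \<comment> \<open>Only with this many candidates does \<open>greedy_selection\<close> constrain
    \<open>sel\<close>.\<close>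
  ultimately have "r j * n \<le> card (V j - S)"
    using card_D[OF j] card_S by linarith
  then have max: "is_arg_max (\<lambda>M. \<Sum>x\<in>M. marginal g S x)
      (\<lambda>M. M \<subseteq> V j - S \<and> card M = r j * n) M"
    using greedy_sel i j t sub
    unfolding greedy_selection_def M_def n_def r_def ground_def by blast
  then have M: "M \<subseteq> V j - S" "card M = r j * n"
    by (auto simp: is_arg_max_def)
  have pos: "0 < r j * n" using r_pos[OF j] n_pos by simp
  have finM: "finite M" "M \<noteq> {}" using M pos card_gt_0_iff by force+
  have supp: "set_pmf (draw i j t S) = (\<lambda>u. insert u S) ` M"
    using finM by (simp add: draw_def M_def[symmetric])
  have "quota c' (insert u S)" if u: "u \<in> M" for u
    unfolding quota_def
  proof (intro conjI ballI)
    show "insert u S \<subseteq> ground" using sub u M V_subset_ground[OF j] by auto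
    fix l assume l: "l \<in> {1..N}"
    show "card (insert u S \<inter> V l) \<le> c' l"
    proof (cases "l = j")
      case True
      have "card (insert u S \<inter> V l) \<le> Suc (card (S \<inter> V l))"
        by (simp add: Int_insert_left card_insert_if finS)
      moreover have "card (S \<inter> V l) \<le> c l"
        using S l by (auto simp: quota_def)
      ultimately show ?thesis using True by (simp add: c')
    next
      case False
      with V_eqI[OF j l] u M have "u \<notin> V l" by blast
      with S l False show ?thesis by (auto simp: quota_def c')
    qed
  qed
  moreover have "h S \<le> measure_pmf.expectation (draw i j t S) h'"
  proof -
    have "real (r j * n) * h S \<le> (\<Sum>u\<in>M. h' (insert u S))"
      by (intro step sub M greedy_gain j card_S max)
    then have "h S \<le> (\<Sum>u\<in>M. h' (insert u S)) / card M"
      using pos M(2) by (simp add: pos_le_divide_eq mult.commute del: of_nat_mult)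
    also have "\<dots> = measure_pmf.expectation (draw i j t S) h'"
      using finM by (simp add: draw_def M_def[symmetric] integral_pmf_of_set)
    finally show ?thesis .
  qed
  ultimately show "finite (set_pmf (draw i j t S)) \<and> (\<forall>s'\<in>set_pmf (draw i j t S). quota c' s') \<and>
      h S \<le> measure_pmf.expectation (draw i j t S) h'"
    using finM by (auto simp: supp)
qed

section \<open>Expected gain over one block\<close>

definition weight :: "nat \<Rightarrow> real" where
  "weight j = r j / k j"

definition block :: "nat \<Rightarrow> 'b set \<Rightarrow> 'b set pmf" where
  "block i = for_loop (\<lambda>j. greedy_subroutine_nonmono (sel i j) (r j)) N"

lemma greedy_subroutine_eq: "greedy_subroutine_nonmono (sel i j) m = for_loop (draw i j) m"
  by (simp add: greedy_subroutine_nonmono_def draw_def[abs_def])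

lemma block_greedy_eq: "block_greedy N k sel = for_loop block n {}"
  by (simp add: block_greedy_def block_def[abs_def] r_def n_def)

lemma drift_subroutine:
  assumes i: "i \<in> {1..n}" and j: "j \<in> {1..N}" and c: "c j + r j \<le> r j * n"
    and c': "c' = c(j := c j + r j)"
    and step: "\<And>m S M. m < r j \<Longrightarrow> S \<subseteq> ground \<Longrightarrow> M \<subseteq> V j - S \<Longrightarrow> card M = r j * n \<Longrightarrow>
      real (r j * n) * gain j S \<le> k j * (\<Sum>x\<in>M. marginal g S x) \<Longrightarrow>
      real (r j * n) * h m S \<le> (\<Sum>u\<in>M. h (Suc m) (insert u S))"
  shows "drift (quota c) (h 0) (greedy_subroutine_nonmono (sel i j) (r j)) (quota c') (h (r j))"
proof -
  have "drift (quota (c(j := c j + 0))) (h 0) (for_loop (draw i j) (r j))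
      (quota (c(j := c j + r j))) (h (r j))"
  proof (rule drift_for_loop[where P = "\<lambda>m. quota (c(j := c j + m))"])
    fix m assume m: "m < r j"
    show "drift (quota (c(j := c j + m))) (h m) (draw i j (Suc m))
        (quota (c(j := c j + Suc m))) (h (Suc m))"
      using m c by (intro drift_draw[OF i j] step) auto
  qed
  then show ?thesis by (simp add: greedy_subroutine_eq c')
qed

text \<open>The conditional in the quota adds the current block's draws for the parts already
  visited; it is trivial before the first part and after the last.\<close>

lemma drift_block:
  assumes i: "i < n"
    and step: "\<And>j. j < N \<Longrightarrow> drift (quota (\<lambda>l. r l * i + (if l \<le> j then r l else 0))) (h j)
      (greedy_subroutine_nonmono (sel (Suc i) (Suc j)) (r (Suc j)))
      (quota (\<lambda>l. r l * i + (if l \<le> Suc j then r l else 0))) (h (Suc j))"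
  shows "drift (quota (\<lambda>l. r l * i)) (h 0) (block (Suc i)) (quota (\<lambda>l. r l * Suc i)) (h N)"
proof -
  have "drift (quota (\<lambda>l. r l * i + (if l \<le> 0 then r l else 0))) (h 0) (block (Suc i))
      (quota (\<lambda>l. r l * i + (if l \<le> N then r l else 0))) (h N)"
    unfolding block_def
    by (rule drift_for_loop[where P = "\<lambda>j. quota (\<lambda>l. r l * i + (if l \<le> j then r l else 0))"])
      (rule step)
  then show ?thesis
    by (rule drift_mono) (auto simp: quota_def)
qed

lemma block_counts:
  assumes "i < n" and "j < N"
  shows "(\<lambda>l. r l * i + (if l \<le> Suc j then r l else 0)) =
      (\<lambda>l. r l * i + (if l \<le> j then r l else 0))
        (Suc j := r (Suc j) * i + (if Suc j \<le> j then r (Suc j) else 0) + r (Suc j))"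
    and "r (Suc j) * i + (if Suc j \<le> j then r (Suc j) else 0) + r (Suc j) \<le> r (Suc j) * n"
proof -
  show "r (Suc j) * i + (if Suc j \<le> j then r (Suc j) else 0) + r (Suc j) \<le> r (Suc j) * n"
    using mult_le_mono2[of "Suc i" n "r (Suc j)"] assms by simp
qed (auto simp: fun_eq_iff)

text \<open>Each draw from part \<open>j\<close> earns at least \<open>1 / k j\<close> of
  \<open>gain j\<close>. Because gains decrease along the run, the earnings of all parts may be
  deducted at the final state of the block, where they can be compared with \<open>OPT\<close> at
  one common set.\<close>

lemma drift_block_gain:
  assumes i: "i < n"
  shows "drift (quota (\<lambda>l. r l * i)) g (block (Suc i)) (quota (\<lambda>l. r l * Suc i))
      (\<lambda>S. g S - (\<Sum>l=1..N. weight l * gain l S))"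
proof -
  have "drift (quota (\<lambda>l. r l * i)) (\<lambda>S. g S - (\<Sum>l=1..0. weight l * gain l S)) (block (Suc i))
      (quota (\<lambda>l. r l * Suc i)) (\<lambda>S. g S - (\<Sum>l=1..N. weight l * gain l S))"
  proof (rule drift_block[OF i, where h = "\<lambda>j S. g S - (\<Sum>l=1..j. weight l * gain l S)"])
    fix j assume j: "j < N"
    let ?j = "Suc j"
    have jN: "?j \<in> {1..N}" using j by simp
    have k_pos: "0 < real (k ?j)"
      using r_le[OF jN] r_pos[OF jN] n_pos by (metis less_le_trans nat_0_less_mult_iff of_nat_0_less_iff)
    \<comment> \<open>After \<open>m\<close> draws from part \<open>?j\<close> the fraction
      \<open>m / k ?j\<close> of its gain is deducted; for \<open>m = r ?j\<close> this fraction is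
      \<open>weight ?j\<close>.\<close>
    define h where "h m S = g S - (\<Sum>l=1..j. weight l * gain l S) - m / k ?j * gain ?j S"
      for m :: nat and S
    have "drift (quota (\<lambda>l. r l * i + (if l \<le> j then r l else 0))) (h 0)
      (greedy_subroutine_nonmono (sel (Suc i) ?j) (r ?j))
      (quota (\<lambda>l. r l * i + (if l \<le> ?j then r l else 0))) (h (r ?j))"
    proof (rule drift_subroutine[OF _ jN block_counts(2,1)[OF i j]])
      fix m S M
      assume S: "S \<subseteq> ground" and M: "M \<subseteq> V ?j - S" "card M = r ?j * n"
        and gain: "real (r ?j * n) * gain ?j S \<le> k ?j * (\<Sum>x\<in>M. marginal g S x)"
      \<comment> \<open>The deduction due after the draw, but evaluated at the old set; at
        \<open>insert u S\<close> it can only be smaller.\<close>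
      let ?C = "(\<Sum>l=1..j. weight l * gain l S) + Suc m / k ?j * gain ?j S"
      have "(\<Sum>u\<in>M. g S + marginal g S u - ?C) \<le> (\<Sum>u\<in>M. h (Suc m) (insert u S))"
      proof (rule sum_mono)
        fix u assume u: "u \<in> M"
        then have "u \<in> ground" using M V_subset_ground[OF jN] by auto
        note le = gain_insert_le[OF _ S this]
        have "(\<Sum>l=1..j. weight l * gain l (insert u S)) \<le> (\<Sum>l=1..j. weight l * gain l S)"
          using j by (intro sum_mono mult_left_mono le) (auto simp: weight_def)
        moreover have "Suc m / k ?j * gain ?j (insert u S) \<le> Suc m / k ?j * gain ?j S"
          by (intro mult_left_mono le jN) auto
        ultimately show "g S + marginal g S u - ?C \<le> h (Suc m) (insert u S)"
          by (simp add: h_def marginal_def)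
      qed
      moreover have "(\<Sum>u\<in>M. g S + marginal g S u - ?C) =
          real (r ?j * n) * (g S - ?C) + (\<Sum>u\<in>M. marginal g S u)"
        by (simp add: sum.distrib sum_subtractf M(2) algebra_simps)
      moreover have "real (r ?j * n) * gain ?j S / k ?j \<le> (\<Sum>u\<in>M. marginal g S u)"
        using gain k_pos by (simp add: pos_divide_le_eq mult.commute del: of_nat_mult)
      \<comment> \<open>Passing from \<open>m\<close> to \<open>Suc m\<close> costs one further
        \<open>gain ?j S / k ?j\<close>, which the greedy choice pays on average.\<close>
      moreover have "real (r ?j * n) * h m S =
          real (r ?j * n) * (g S - ?C) + real (r ?j * n) * gain ?j S / k ?j"
        using k_pos by (simp add: h_def field_simps)
      ultimately show "real (r ?j * n) * h m S \<le> (\<Sum>u\<in>M. h (Suc m) (insert u S))"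
        by linarith
    qed (use i in auto)
    then show "drift (quota (\<lambda>l. r l * i + (if l \<le> j then r l else 0)))
      (\<lambda>S. g S - (\<Sum>l=1..j. weight l * gain l S))
      (greedy_subroutine_nonmono (sel (Suc i) ?j) (r ?j))
      (quota (\<lambda>l. r l * i + (if l \<le> ?j then r l else 0)))
      (\<lambda>S. g S - (\<Sum>l=1..?j. weight l * gain l S))"
      by (simp add: h_def[abs_def] weight_def algebra_simps)
  qed
  then show ?thesis by simp
qed

text \<open>The gains jointly dominate the marginals of \<open>OPT - S\<close>, and
  \<open>k_le\<close> makes every weight at least \<open>1 / (n + 1)\<close>.\<close>

lemma weighted_gain_ge:
  assumes "S \<subseteq> ground"
  shows "(g (S \<union> OPT) - g S) / (real n + 1) \<le> (\<Sum>l=1..N. weight l * gain l S)"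
proof -
  have "g (S \<union> OPT) - g S = g (S \<union> (OPT - S)) - g S" by simp
  also have "\<dots> \<le> (\<Sum>x\<in>OPT - S. marginal g S x)"
    using assms OPT_subset finite_OPT by (intro submodular_union_le[OF g_submodular]) auto
  also have "\<dots> \<le> (\<Sum>x\<in>OPT - S. max 0 (marginal g S x))"
    by (intro sum_mono) auto
  also have "OPT - S = (\<Union>l\<in>{1..N}. OPT \<inter> V l - S)"
    using OPT_subset by (auto simp: ground_def)
  also have "(\<Sum>x\<in>\<dots>. max 0 (marginal g S x)) = (\<Sum>l=1..N. gain l S)"
    unfolding gain_def using finite_OPT disjoint_V
    by (intro sum.UNION_disjoint) (auto simp: disjoint_family_on_def)
  finally have "(g (S \<union> OPT) - g S) / (real n + 1) \<le> (\<Sum>l=1..N. gain l S) / (real n + 1)"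
    by (intro divide_right_mono) auto
  also have "\<dots> = (\<Sum>l=1..N. 1 / (real n + 1) * gain l S)"
    by (simp add: sum_divide_distrib)
  also have "\<dots> \<le> (\<Sum>l=1..N. weight l * gain l S)"
  proof (intro sum_mono mult_right_mono)
    fix l assume l: "l \<in> {1..N}"
    have "0 < real (k l)"
      using r_le[OF l] r_pos[OF l] n_pos by (metis less_le_trans nat_0_less_mult_iff of_nat_0_less_iff)
    moreover have "real (k l) \<le> real (r l) * (real n + 1)"
      using k_le[OF l] by (metis of_nat_le_iff of_nat_mult of_nat_add of_nat_1)
    ultimately show "1 / (real n + 1) \<le> weight l"
      by (simp add: weight_def field_simps)
    show "0 \<le> gain l S" by (auto simp: gain_def intro: sum_nonneg)
  qed
  finally show ?thesis .
qed

section \<open>Survival of a fixed element through one block\<close>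

definition q :: real where "q = 1 - 1 / real n"

lemma q_nonneg: "0 \<le> q" and q_le_1: "q \<le> 1"
  using n_pos by (auto simp: q_def)

text \<open>Only draws from part \<open>j0\<close> can select \<open>u\<close>, each with
  probability at most \<open>1 / (r j0 * n)\<close>; Bernoulli's inequality combines the
  \<open>r j0\<close> of them.\<close>

lemma drift_block_avoid:
  assumes i: "i < n" and u: "u \<in> V j0" and j0: "j0 \<in> {1..N}"
  shows "drift (quota (\<lambda>l. r l * i)) (\<lambda>S. q * of_bool (u \<notin> S)) (block (Suc i))
      (quota (\<lambda>l. r l * Suc i)) (\<lambda>S. of_bool (u \<notin> S))"
proof -
  \<comment> \<open>The factor \<open>q\<close> is spent once, when the loop passes part
    \<open>j0\<close>.\<close>
  define h where "h j S = (if j0 \<le> j then 1 else q) * of_bool (u \<notin> S)" for j and S :: "'b set"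
  have "drift (quota (\<lambda>l. r l * i)) (h 0) (block (Suc i)) (quota (\<lambda>l. r l * Suc i)) (h N)"
  proof (rule drift_block[OF i])
    fix j assume j: "j < N"
    let ?j = "Suc j"
    have jN: "?j \<in> {1..N}" using j by simp
    define m where "m = r ?j * n"
    have m: "0 < m"
      using r_pos[OF jN] n_pos by (simp add: m_def)
    then have m1: "1 / real m \<le> 1"
      by simp
    \<comment> \<open>\<open>b\<close> bounds from below the chance that one draw from part
      \<open>?j\<close> misses \<open>u\<close>; \<open>h'\<close> below spends one factor
      \<open>b\<close> per draw, and \<open>a\<close> is the outer factor left after this
      part.\<close>
    define b where "b = (if j0 = ?j then 1 - 1 / real m else 1)"
    define a where "a = (if j0 \<le> ?j then 1 else q)"
    define h' where "h' t S = a * b ^ (r ?j - t) * of_bool (u \<notin> S)" for t and S :: "'b set"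
    have "drift (quota (\<lambda>l. r l * i + (if l \<le> j then r l else 0))) (h' 0)
      (greedy_subroutine_nonmono (sel (Suc i) ?j) (r ?j))
      (quota (\<lambda>l. r l * i + (if l \<le> ?j then r l else 0))) (h' (r ?j))"
    proof (rule drift_subroutine[OF _ jN block_counts(2,1)[OF i j]])
      fix t S M
      assume t: "t < r ?j" and M: "M \<subseteq> V ?j - S" "card M = r ?j * n"
      define e where "e = a * b ^ (r ?j - Suc t)"
      have e: "h' t S = e * (b * of_bool (u \<notin> S))" "\<And>S. h' (Suc t) S = e * of_bool (u \<notin> S)"
        using t by (auto simp: h'_def e_def Suc_diff_Suc[symmetric])
      have "0 \<le> e" using q_nonneg m1 by (auto simp: e_def a_def b_def)
      have finM: "finite M" using M(2) m card_ge_0_finite unfolding m_def by metis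
      have "m * (b * of_bool (u \<notin> S)) \<le> (\<Sum>x\<in>M. of_bool (u \<notin> insert x S))"
      proof (cases "u \<in> S")
        case False
        have "(\<Sum>x\<in>M. of_bool (u \<notin> insert x S)) = (\<Sum>x\<in>M. of_bool (x \<in> - {u}) :: real)"
          using False by (intro sum.cong) auto
        also have "\<dots> = real (card (M - {u}))"
          using finM by (simp add: sum_of_bool_eq Diff_eq Compl_eq)
        finally have sum: "(\<Sum>x\<in>M. of_bool (u \<notin> insert x S)) = real (card (M - {u}))" .
        show ?thesis
        proof (cases "j0 = ?j")
          case True
          have "real m - 1 \<le> real (card (M - {u}))"
            using M(2) finM m by (simp add: card_Diff_singleton_if m_def of_nat_diff)
          moreover have "m * b = real m - 1"
            using True m by (simp add: b_def field_simps)
          ultimately show ?thesis using False sum by simp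
        next
          case False': False
          with V_eqI[OF j0 jN u] M have "u \<notin> M" by auto
          then show ?thesis using False False' sum M(2) by (simp add: b_def m_def)
        qed
      qed (auto intro: sum_nonneg)
      then have "e * (m * (b * of_bool (u \<notin> S))) \<le> e * (\<Sum>x\<in>M. of_bool (u \<notin> insert x S))"
        using \<open>0 \<le> e\<close> by (intro mult_left_mono)
      then show "real (r ?j * n) * h' t S \<le> (\<Sum>x\<in>M. h' (Suc t) (insert x S))"
        unfolding e m_def[symmetric] by (simp add: sum_distrib_left mult.left_commute)
    qed (use i in auto)
    moreover have "h j S \<le> h' 0 S" for S
    proof (cases "j0 = ?j")
      case True
      \<comment> \<open>Since \<open>m = r ?j * n\<close>, the exponent \<open>r ?j\<close> in
        Bernoulli's inequality leaves exactly \<open>1 - 1/n\<close>.\<close>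
      have "q = 1 + real (r ?j) * (- 1 / m)"
        using r_pos[OF jN] n_pos by (simp add: q_def m_def)
      also have "\<dots> \<le> (1 + (- 1 / m)) ^ r ?j"
        using m1 by (intro Bernoulli_inequality) auto
      finally have "q \<le> b ^ r ?j" using True by (simp add: b_def)
      then show ?thesis using True by (simp add: h_def h'_def a_def)
    qed (auto simp: h_def h'_def a_def b_def)
    moreover have "h' (r ?j) S = h ?j S" for S
      by (simp add: h_def h'_def a_def)
    ultimately show "drift (quota (\<lambda>l. r l * i + (if l \<le> j then r l else 0))) (h j)
      (greedy_subroutine_nonmono (sel (Suc i) ?j) (r ?j))
      (quota (\<lambda>l. r l * i + (if l \<le> ?j then r l else 0))) (h ?j)"
      by (elim drift_mono) auto
  qed
  moreover have "h 0 = (\<lambda>S. q * of_bool (u \<notin> S))" "h N = (\<lambda>S. of_bool (u \<notin> S))"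
    using j0 by (auto simp: h_def)
  ultimately show ?thesis by simp
qed

section \<open>Expectations over the whole run\<close>

lemma for_loop_block:
  assumes "i \<le> n"
  shows "finite (set_pmf (for_loop block i {}))"
    and "\<And>S. S \<in> set_pmf (for_loop block i {}) \<Longrightarrow> quota (\<lambda>l. r l * i) S"
proof -
  \<comment> \<open>With the zero potential, only the support information in the drift
    remains.\<close>
  have "drift (quota (\<lambda>l. r l * 0)) (\<lambda>_. 0) (for_loop block i) (quota (\<lambda>l. r l * i)) (\<lambda>_. 0)"
  proof (rule drift_for_loop[where P = "\<lambda>i. quota (\<lambda>l. r l * i)"])
    fix i' assume "i' < i"
    with assms have "drift (quota (\<lambda>l. r l * i')) g (block (Suc i')) (quota (\<lambda>l. r l * Suc i'))
      (\<lambda>S. g S - (\<Sum>l=1..N. weight l * gain l S))"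
      by (intro drift_block_gain) auto
    then show "drift (quota (\<lambda>l. r l * i')) (\<lambda>_. 0) (block (Suc i')) (quota (\<lambda>l. r l * Suc i')) (\<lambda>_. 0)"
      by (simp add: drift_def)
  qed
  moreover have "quota (\<lambda>l. r l * 0) {}" by (simp add: quota_def)
  ultimately show "finite (set_pmf (for_loop block i {}))"
    and "\<And>S. S \<in> set_pmf (for_loop block i {}) \<Longrightarrow> quota (\<lambda>l. r l * i) S"
    by (auto simp: drift_def)
qed

lemma avoid_probability:
  assumes "i \<le> n" and "u \<in> ground"
  shows "q ^ i \<le> measure_pmf.expectation (for_loop block i {}) (\<lambda>S. of_bool (u \<notin> S))"
proof -
  obtain j where j: "j \<in> {1..N}" "u \<in> V j" using assms(2) by (auto simp: ground_def)
  \<comment> \<open>The exponent counts the blocks still to come.\<close>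
  define h where "h i' S = q ^ (i - i') * of_bool (u \<notin> S)" for i' and S :: "'b set"
  have "drift (quota (\<lambda>l. r l * 0)) (h 0) (for_loop block i) (quota (\<lambda>l. r l * i)) (h i)"
  proof (rule drift_for_loop[where P = "\<lambda>i. quota (\<lambda>l. r l * i)"])
    fix i' assume i': "i' < i"
    with assms have "drift (quota (\<lambda>l. r l * i')) (\<lambda>S. q * of_bool (u \<notin> S)) (block (Suc i'))
      (quota (\<lambda>l. r l * Suc i')) (\<lambda>S. of_bool (u \<notin> S))"
      by (intro drift_block_avoid[OF _ j(2,1)]) auto
    moreover have "0 \<le> q ^ (i - Suc i')" using q_nonneg by simp
    moreover have "h i' S = q ^ (i - Suc i') * (q * of_bool (u \<notin> S))" for S
      using i' by (simp add: h_def Suc_diff_Suc[symmetric])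
    moreover have "measure_pmf.expectation p (h (Suc i')) =
        q ^ (i - Suc i') * measure_pmf.expectation p (\<lambda>S. of_bool (u \<notin> S))" for p
      by (simp add: h_def[abs_def])
    ultimately show "drift (quota (\<lambda>l. r l * i')) (h i') (block (Suc i'))
        (quota (\<lambda>l. r l * Suc i')) (h (Suc i'))"
      unfolding drift_def by (metis mult_left_mono)
  qed
  moreover have "quota (\<lambda>l. r l * 0) {}" by (simp add: quota_def)
  ultimately have "h 0 {} \<le> measure_pmf.expectation (for_loop block i {}) (h i)"
    by (auto simp: drift_def)
  then show ?thesis by (simp add: h_def[abs_def])
qed

text \<open>The sampling bound \<open>submodular_expectation_ge\<close> is applied to
  \<open>g (S \<union> OPT)\<close> with \<open>P = 1 - q ^ i\<close>, the largest probability with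
  which an element can have been selected.\<close>

lemma expectation_union_OPT:
  assumes "i \<le> n"
  shows "q ^ i * g OPT \<le> measure_pmf.expectation (for_loop block i {}) (\<lambda>S. g (S \<union> OPT))"
proof -
  let ?p = "for_loop block i {}"
  note fin = for_loop_block(1)[OF assms] and supp = for_loop_block(2)[OF assms]
  have "(1 - (1 - q ^ i)) * g ({} \<union> OPT) \<le> measure_pmf.expectation ?p (\<lambda>S. g (S \<union> OPT))"
  proof (rule submodular_expectation_ge[OF submodular_on_union[OF g_submodular OPT_subset]
        _ finite_ground])
    show "0 \<le> g (A \<union> OPT)" if "A \<subseteq> ground" for A
      using that OPT_subset by (intro g_nonneg) auto
    show "A \<subseteq> ground" if "A \<in> set_pmf ?p" for A
      using supp[OF that] by (simp add: quota_def)
    show "0 \<le> 1 - q ^ i" using q_nonneg q_le_1 by (simp add: power_le_one)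
    fix u assume "u \<in> ground"
    then have "q ^ i \<le> measure_pmf.expectation ?p (\<lambda>S. 1 - of_bool (u \<in> S))"
      using avoid_probability[OF assms] by (simp add: of_bool_not_iff)
    also have "\<dots> = 1 - measure_pmf.expectation ?p (\<lambda>S. of_bool (u \<in> S))"
      by (subst Bochner_Integration.integral_diff)
        (auto intro: integrable_measure_pmf_finite[OF fin])
    finally show "measure_pmf.expectation ?p (\<lambda>S. of_bool (u \<in> S)) \<le> 1 - q ^ i"
      by simp
  qed
  then show ?thesis by simp
qed

lemma expectation_recursion:
  assumes "i < n"
  defines "a \<equiv> \<lambda>i. measure_pmf.expectation (for_loop block i {}) g"
  shows "a i + (q ^ Suc i * g OPT - a (Suc i)) / (real n + 1) \<le> a (Suc i)"
proof -
  let ?p = "for_loop block (Suc i) {}"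
  have si: "Suc i \<le> n" using assms by simp
  note fin = for_loop_block(1)[OF si] and supp = for_loop_block(2)[OF si]
  note int = integrable_measure_pmf_finite[OF fin]
  \<comment> \<open>The first \<open>i\<close> blocks are viewed as a step from \<open>{}\<close>
    with constant potential, so that they chain with block \<open>Suc i\<close>.\<close>
  have "drift (\<lambda>S. S = {}) (\<lambda>_. a i) (for_loop block i) (quota (\<lambda>l. r l * i)) g"
    using for_loop_block[of i] assms by (auto simp: drift_def)
  from drift_bind_pmf[OF this drift_block_gain[OF assms(1)]]
  have "a i \<le> measure_pmf.expectation ?p (\<lambda>S. g S - (\<Sum>l=1..N. weight l * gain l S))"
    by (simp add: drift_def)
  also have "\<dots> \<le> measure_pmf.expectation ?p (\<lambda>S. g S - (g (S \<union> OPT) - g S) / (real n + 1))"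
    using supp weighted_gain_ge
    by (intro expectation_mono_pmf fin diff_left_mono) (auto simp: quota_def)
  also have "\<dots> = a (Suc i) -
      (measure_pmf.expectation ?p (\<lambda>S. g (S \<union> OPT)) - a (Suc i)) / (real n + 1)"
    by (simp add: a_def int del: for_loop.simps)
  also have "\<dots> \<le> a (Suc i) - (q ^ Suc i * g OPT - a (Suc i)) / (real n + 1)"
    using expectation_union_OPT[OF si] by (intro diff_left_mono divide_right_mono diff_right_mono) auto
  finally show ?thesis by simp
qed

text \<open>The recursion multiplies the old value by \<open>(n + 1) / (n + 2)\<close>, which is at
  least \<open>q\<close>, and adds \<open>q ^ Suc i * g OPT / (n + 2)\<close>. So block
  \<open>i + 1\<close> raises the count of terms from \<open>i\<close> to \<open>i + 1\<close> at
  the price of one factor \<open>q\<close>.\<close>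

lemma expectation_ge:
  assumes "i \<le> n"
  shows "real i * q ^ i * g OPT / (real n + 2) \<le> measure_pmf.expectation (for_loop block i {}) g"
  using assms
proof (induction i)
  case 0
  then show ?case using g_nonneg[of "{}"] by simp
next
  case (Suc i)
  define a b where "a = measure_pmf.expectation (for_loop block i {}) g"
    and "b = measure_pmf.expectation (for_loop block (Suc i) {}) g"
  define x where "x = q ^ i * g OPT"
  have x: "0 \<le> x" using g_nonneg[OF OPT_subset] q_nonneg by (simp add: x_def)
  have IH: "i * x \<le> (real n + 2) * a"
    using Suc by (simp add: a_def x_def pos_divide_le_eq mult.assoc mult.commute mult.left_commute)
  have "a + (q * x - b) / (real n + 1) \<le> b"
    using expectation_recursion[of i] Suc(2)
    by (simp add: a_def b_def x_def mult.assoc del: for_loop.simps)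
  then have "(q * x - b) / (real n + 1) \<le> b - a"
    by linarith
  then have "q * x - b \<le> (b - a) * (real n + 1)"
    by (subst (asm) pos_divide_le_eq) auto
  then have rec: "a * (real n + 1) + q * x \<le> (real n + 2) * b"
    by (simp add: algebra_simps)
  have "q * (real n + 2) \<le> real n + 1"
    using n_pos by (simp add: q_def field_simps)
  then have "(q * (real n + 2)) * (i * x) \<le> (real n + 1) * (i * x)"
    using x by (intro mult_right_mono) auto
  also have "\<dots> \<le> (real n + 1) * ((real n + 2) * a)"
    using IH by (intro mult_left_mono) auto
  finally have "(real n + 2) * (q * (i * x)) \<le> (real n + 2) * (a * (real n + 1))"
    by (simp add: algebra_simps)
  then have "q * (i * x) \<le> a * (real n + 1)"
    by (subst (asm) mult_le_cancel_left_pos) auto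
  with rec have "Suc i * (q * x) \<le> (real n + 2) * b"
    by (simp add: algebra_simps)
  then have "Suc i * (q * x) / (real n + 2) \<le> b"
    by (simp add: pos_divide_le_eq mult.commute)
  then show ?case
    by (simp add: b_def x_def mult.assoc del: for_loop.simps)
qed

theorem block_greedy_guarantee:
  "(1 / exp 1 - 3 / (exp 1 * (real n + 1))) * g OPT
     \<le> measure_pmf.expectation (block_greedy N k sel) g"
proof -
  have O: "0 \<le> g OPT" by (rule g_nonneg[OF OPT_subset])
  have n1: "1 \<le> real n" using n_pos by simp
  have "1 / exp 1 - 3 / (exp 1 * (real n + 1)) = exp (-1) * (1 - 3 / (real n + 1))"
    by (simp add: exp_minus divide_inverse right_diff_distrib)
  also have "\<dots> \<le> exp (-1) * (1 - 3 / (real n + 2))"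
    by (intro mult_left_mono diff_left_mono divide_left_mono) auto
  also have "\<dots> = exp (-1) * ((real n - 1) / (real n + 2))"
    by (simp add: field_simps)
  also have "\<dots> \<le> q ^ (n - 1) * ((real n - 1) / (real n + 2))"
    using one_minus_inverse_power_ge[OF n_pos] n1 by (intro mult_right_mono) (auto simp: q_def)
  \<comment> \<open>The numerator supplies the factor \<open>q\<close> that turns the exponent
    \<open>n - 1\<close>, for which the bound \<open>1/e\<close> holds, into
    \<open>n\<close>.\<close>
  also have "real n - 1 = real n * q"
    using n1 by (simp add: q_def field_simps)
  also have "q ^ (n - 1) * (real n * q / (real n + 2)) = real n * q ^ n / (real n + 2)"
    using n_pos by (cases n) auto
  finally have "(1 / exp 1 - 3 / (exp 1 * (real n + 1))) * g OPT
      \<le> real n * q ^ n / (real n + 2) * g OPT"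
    using O by (intro mult_right_mono)
  with expectation_ge[of n] show ?thesis
    by (simp add: block_greedy_eq)
qed

end

section \<open>Transfer to the original ground set\<close>

theorem theorem8:
  fixes U :: "'a set" and Us :: "nat \<Rightarrow> 'a set" and f :: "'a set \<Rightarrow> real"
    and N :: nat and k d :: "nat \<Rightarrow> nat"
    and sel :: "nat \<Rightarrow> nat \<Rightarrow> nat \<Rightarrow> ('a + nat \<times> nat) set \<Rightarrow> ('a + nat \<times> nat) set"
    and OPT :: "'a set"
  assumes "finite U"
    and "\<forall>S \<subseteq> U. 0 \<le> f S"
    and "submodular_on U f"
    and "1 \<le> N"
    and "(\<Union>j\<in>{1..N}. Us j) = U" and "disjoint_family_on Us {1..N}"
    and "\<forall>j\<in>{1..N}. 1 \<le> k j \<and> k j \<le> card (Us j)"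
    and "\<forall>j\<in>{1..N}. 2 * (block_size N k j * num_blocks N k) \<le> card (dummies f U (Us j)) + d j"
    and "greedy_selection (pad_fun f) (pad_part d Us) N k sel"
    and "is_arg_max f (\<lambda>S. S \<in> feasible U Us N k) OPT"
  shows "measure_pmf.expectation (block_greedy N k sel) (pad_fun f)
           \<ge> (1 / exp 1 - 3 / (exp 1 * (real (num_blocks N k) + 1))) * f OPT"
proof -
  have OPT: "OPT \<subseteq> U" "\<And>j. j \<in> {1..N} \<Longrightarrow> card (OPT \<inter> Us j) \<le> k j"
    using assms(10) by (auto simp: is_arg_max_def feasible_def)
  have vimage: "Inl -` insert (Inl y) S = insert y (Inl -` S)" "Inl -` insert (Inr z) S = Inl -` S"
    for y :: 'a and z :: "nat \<times> nat" and S :: "('a + nat \<times> nat) set"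
    by auto
  have pad_OPT: "pad_fun f (Inl ` OPT) = f OPT"
    by (simp add: pad_fun_def inj_vimage_image_eq)
  show ?thesis
  proof (cases "num_blocks N k = 0")
    case True
    \<comment> \<open>Without blocks the output is \<open>{}\<close> and the claimed factor is
      negative.\<close>
    have "(1 / exp 1 - 3 / exp 1) * f OPT \<le> 0"
      using OPT(1) assms(2) by (intro mult_nonpos_nonneg) (auto simp: field_simps)
    moreover have "0 \<le> f {}" using assms(2) by auto
    ultimately show ?thesis
      using True by (simp add: block_greedy_def pad_fun_def)
  next
    case False
    have UsU: "Us j \<subseteq> U" if "j \<in> {1..N}" for j using assms(5) that by blast
    \<comment> \<open>Both kinds of dummies count: original elements that \<open>f\<close> ignores,
      and the fresh ones, tagged by \<open>j\<close> to keep the parts disjoint.\<close>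
    define D where "D j = Inl ` dummies f U (Us j) \<union> Inr ` ({j} \<times> {..<d j})" for j
    have Inl_U: "Inl -` S \<subseteq> U" if "S \<subseteq> (\<Union>l\<in>{1..N}. pad_part d Us l)" for S
      using that UsU by (fastforce simp: pad_part_def)
    have Inl_mem: "x \<in> U" if "Inl x \<in> (\<Union>l\<in>{1..N}. pad_part d Us l)" for x
      using that UsU by (fastforce simp: pad_part_def)
    interpret padded_instance "pad_part d Us" N k "pad_fun f" sel "Inl ` OPT" D
      "\<Union>l\<in>{1..N}. pad_part d Us l" "num_blocks N k" "block_size N k"
    proof (unfold_locales; (simp only: reflexive)?)
      fix j assume j: "j \<in> {1..N}"
      have finj: "finite (Us j)" using UsU[OF j] assms(1) finite_subset by blast
      then show "finite (pad_part d Us j)" by (simp add: pad_part_def)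
      show "D j \<subseteq> pad_part d Us j" by (auto simp: D_def dummies_def pad_part_def)
      have "Inl ` OPT \<inter> pad_part d Us j = Inl ` (OPT \<inter> Us j)" by (auto simp: pad_part_def)
      then show "card (Inl ` OPT \<inter> pad_part d Us j) \<le> k j"
        using OPT(2)[OF j] by (simp add: card_image)
      have "finite (dummies f U (Us j))" using finj by (simp add: dummies_def)
      then have "card (D j) = card (dummies f U (Us j)) + d j"
        unfolding D_def
        by (subst card_Un_disjoint) (auto simp: card_image card_cartesian_product)
      with assms(8) j show "2 * (block_size N k j * num_blocks N k) \<le> card (D j)" by simp
      fix x S assume "x \<in> D j" and S: "S \<subseteq> (\<Union>l\<in>{1..N}. pad_part d Us l)"
      then show "pad_fun f (insert x S) = pad_fun f S"
        using Inl_U[OF S] by (auto simp: D_def pad_fun_def dummies_def vimage)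
    next
      show "disjoint_family_on (pad_part d Us) {1..N}"
        using assms(6) by (auto simp: disjoint_family_on_def pad_part_def)
      show "0 \<le> pad_fun f S" if "S \<subseteq> (\<Union>l\<in>{1..N}. pad_part d Us l)" for S
        using Inl_U[OF that] assms(2) by (simp add: pad_fun_def)
      show "Inl ` OPT \<subseteq> (\<Union>l\<in>{1..N}. pad_part d Us l)"
        using OPT(1) assms(5) by (fastforce simp: pad_part_def)
      show "0 < num_blocks N k" using False by simp
      show "greedy_selection (pad_fun f) (pad_part d Us) N k sel" by fact
      show "submodular_on (\<Union>l\<in>{1..N}. pad_part d Us l) (pad_fun f)"
        unfolding submodular_on_def
      proof (intro allI impI)
        fix A B x assume *: "A \<subseteq> B \<and> B \<subseteq> (\<Union>l\<in>{1..N}. pad_part d Us l) \<and>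
          x \<in> (\<Union>l\<in>{1..N}. pad_part d Us l) - B"
        \<comment> \<open>A fresh element leaves the preimage under \<open>Inl\<close> unchanged, so
          both its marginals are 0; an original one inherits the inequality from
          \<open>f\<close>.\<close>
        show "marginal (pad_fun f) B x \<le> marginal (pad_fun f) A x"
        proof (cases x)
          case (Inl y)
          have "marginal f (Inl -` B) y \<le> marginal f (Inl -` A) y"
            using * Inl Inl_U[of B] Inl_mem[of y] by (intro submodular_onD[OF assms(3)]) auto
          then show ?thesis by (simp add: marginal_def pad_fun_def Inl vimage)
        next
          case (Inr y)
          then show ?thesis by (simp add: marginal_def pad_fun_def vimage)
        qed
      qed
    qed
    show ?thesis using block_greedy_guarantee by (simp add: pad_OPT)
  qed
qed

end
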